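(* Let $p=p(n)\in[0,1/2]$ satisfy $n\,p(n)\to\infty$ as $n\to\infty$ (i.e., $p\in\omega(1/n)$). For every $n$, let $T$ be a random tournament on $n$ alternatives generated according to the Condorcet random model with parameter $p$. Then with high probability (i.e., with probability tending to $1$ as $n\to\infty$), every alternative in $T$ is a $5$-king.
   Context: A tournament on a finite set $V$ of alternatives is a complete orientation: for every two distinct $x,y\in V$ exactly one of $x\succ y$ ("$x$ dominates $y$") or $y\succ x$ holds. For an integer $k\ge 2$, an alternative $x$ is a $k$-king if for every other alternative $y$ there is a directed path from $x$ to $y$ of length (number of edges) at most $k$. Condorcet random model with parameter $0\le p\le 1/2$: alternatives are $x_1,\dots,x_n$; independently for each pair $i<j$, $x_j\succ x_i$ with probability $p$ and $x_i\succ x_j$ with probability $1-p$. *)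

theory Defs
  imports "HOL-Probability.Product_PMF" "Graph_Theory.Pair_Digraph"
begin

locale tournament = pair_digraph +
  assumes exactly_one: "x \<in> pverts G \<Longrightarrow> y \<in> pverts G \<Longrightarrow> x \<noteq> y \<Longrightarrow>
      (x, y) \<in> parcs G \<longleftrightarrow> (y, x) \<notin> parcs G"

definition king :: "nat \<Rightarrow> 'a pair_pre_digraph \<Rightarrow> 'a \<Rightarrow> bool" where
  "king k T x \<longleftrightarrow> x \<in> pverts T \<and>
     (\<forall>y \<in> pverts T. y \<noteq> x \<longrightarrow>
        (\<exists>P. pre_digraph.apath (with_proj T) x P y \<and> length P \<le> k))"

definition index_pairs :: "nat \<Rightarrow> (nat \<times> nat) set" where
  "index_pairs n = {(i, j). 1 \<le> i \<and> i < j \<and> j \<le> n}"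

text \<open>The Boolean \<open>r (i, j)\<close>, for \<open>i < j\<close>, says that the weaker alternative \<open>j\<close>
  dominates the stronger alternative \<open>i\<close>.\<close>

definition tournament_of :: "nat \<Rightarrow> (nat \<times> nat \<Rightarrow> bool) \<Rightarrow> nat pair_pre_digraph" where
  "tournament_of n r =
     \<lparr> pverts = {1..n},
       parcs = {(i, j) \<in> index_pairs n. \<not> r (i, j)} \<union>
               {(j, i) | i j. (i, j) \<in> index_pairs n \<and> r (i, j)} \<rparr>"

text \<open>\<open>bernoulli_pmf p\<close> is the intended distribution only for \<open>0 \<le> p \<le> 1\<close>; users of
  \<open>condorcet_pmf\<close> have to assume this range.\<close>

definition condorcet_pmf :: "nat \<Rightarrow> real \<Rightarrow> nat pair_pre_digraph pmf" where
  "condorcet_pmf n p =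
     map_pmf (tournament_of n) (Pi_pmf (index_pairs n) False (\<lambda>_. bernoulli_pmf p))"

lemma finite_index_pairs [simp]: "finite (index_pairs n)"
  by (rule finite_subset[of _ "{1..n} \<times> {1..n}"]) (auto simp: index_pairs_def)

lemma tournament_tournament_of: "tournament (tournament_of n r)"
proof
  show "finite (parcs (tournament_of n r))"
    by (rule finite_subset[of _ "{1..n} \<times> {1..n}"]) (auto simp: tournament_of_def index_pairs_def)
qed (auto simp: tournament_of_def index_pairs_def)

lemma tournament_condorcet_pmf:
  assumes "T \<in> set_pmf (condorcet_pmf n p)"
  shows "tournament T" "pverts T = {1..n}"
  using assms tournament_tournament_of
  by (auto simp: condorcet_pmf_def tournament_of_def)

lemma prob_condorcet_reversed:
  assumes "0 \<le> p" "p \<le> 1" "1 \<le> i" "i < j" "j \<le> n"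
  shows "measure_pmf.prob (condorcet_pmf n p) {T. (j, i) \<in> parcs T} = p"
proof -
  let ?M = "Pi_pmf (index_pairs n) False (\<lambda>_. bernoulli_pmf p)"
  have ij: "(i, j) \<in> index_pairs n"
    using assms by (auto simp: index_pairs_def)
  have "tournament_of n -` {T. (j, i) \<in> parcs T} = (\<lambda>f. f (i, j)) -` {True}"
    using assms ij by (auto simp: tournament_of_def index_pairs_def)
  then have "measure_pmf.prob (condorcet_pmf n p) {T. (j, i) \<in> parcs T}
      = measure_pmf.prob (map_pmf (\<lambda>f. f (i, j)) ?M) {True}"
    by (simp add: condorcet_pmf_def)
  also have "map_pmf (\<lambda>f. f (i, j)) ?M = bernoulli_pmf p"
    using ij by (subst Pi_pmf_component) auto
  finally show ?thesis
    using assms by (simp add: measure_pmf_single)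
qed

end

theory Submission
  imports Defs "HOL-Real_Asymp.Real_Asymp" "HOL-Library.Discrete_Functions"
begin

text \<open>
  Split the alternatives by strength into five consecutive blocks \<open>U\<close>, \<open>A\<close>, \<open>M\<close>, \<open>C\<close>, \<open>L\<close>, all of
  size \<open>q = n div 5\<close> except \<open>M\<close>, which also takes the remainder. With high probability every
  \<open>a \<in> A\<close> reaches every \<open>b \<in> C\<close> in two steps through \<open>M\<close>. Call an alternative close to \<open>A\<close> if it
  reaches \<open>A\<close> in at most one step. With high probability all of \<open>U \<union> A\<close> is close to \<open>A\<close>, and so
  are, since \<open>n p\<close> tends to infinity, the \<open>K\<close> weakest alternatives, for any constant \<open>K\<close>. Any
  other \<open>x\<close> has \<open>k \<ge> K\<close> weaker alternatives in \<open>L\<close>. Cut \<open>A\<close> into \<open>s = floor_sqrt k\<close> parts: through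
  its weaker alternatives \<open>x\<close> reaches each of these parts in two steps, hence at least \<open>s\<close>
  elements of \<open>A\<close>, except with probability \<open>s exp (- s / 4)\<close>, which is summable over \<open>k\<close>. By
  symmetry, the same holds for reaching \<open>y\<close> from \<open>C\<close> through \<open>U\<close>, with \<open>t\<close> elements of \<open>C\<close>. If \<open>x\<close>
  or \<open>y\<close> is close, this gives a path of length at most \<open>1 + 2 + 2\<close>. If neither is, the orientations
  of the \<open>s t\<close> pairs between the elements of \<open>A\<close> and \<open>C\<close> found in this way are independent of the
  two searches, so one of the direct arcs is present except with probability \<open>2 powr (- s t)\<close>,
  again summable over both indices, and the path has length \<open>2 + 1 + 2\<close>.
\<close>

subsection \<open>Events depending on disjoint sets of coordinates\<close>

text \<open>Stands in for measurability with respect to the coordinates in \<open>S\<close>. The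
  value type is free, so that it covers events as well as the random sets found by a search.\<close>

definition depends_on :: "'a set \<Rightarrow> (('a \<Rightarrow> 'b) \<Rightarrow> 'c) \<Rightarrow> bool" where
  "depends_on S X \<longleftrightarrow> (\<forall>f g. (\<forall>i\<in>S. f i = g i) \<longrightarrow> X f = X g)"

lemma depends_onI: "(\<And>f g. (\<And>i. i \<in> S \<Longrightarrow> f i = g i) \<Longrightarrow> X f = X g) \<Longrightarrow> depends_on S X"
  unfolding depends_on_def by blast

lemma depends_onD: "depends_on S X \<Longrightarrow> (\<And>i. i \<in> S \<Longrightarrow> f i = g i) \<Longrightarrow> X f = X g"
  unfolding depends_on_def by blast

text \<open>The library's product rule asks for countable sets, so both factors are first cut down
  to the supports.\<close>

lemma prob_pair_pmf_Times:
  "measure_pmf.prob (pair_pmf M N) (A \<times> B) = measure_pmf.prob M A * measure_pmf.prob N B"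
proof -
  have "measure_pmf.prob (pair_pmf M N) (A \<times> B)
      = measure_pmf.prob (pair_pmf M N) (A \<times> B \<inter> set_pmf (pair_pmf M N))"
    by (rule measure_Int_set_pmf[symmetric])
  also have "A \<times> B \<inter> set_pmf (pair_pmf M N) = (A \<inter> set_pmf M) \<times> (B \<inter> set_pmf N)"
    by auto
  also have "measure_pmf.prob (pair_pmf M N) \<dots>
      = measure_pmf.prob M (A \<inter> set_pmf M) * measure_pmf.prob N (B \<inter> set_pmf N)"
    by (rule measure_pmf_prob_product) auto
  finally show ?thesis
    by (simp only: measure_Int_set_pmf)
qed

lemma prob_neg: "measure_pmf.prob M {r. \<not> E r} = 1 - measure_pmf.prob M {r. E r}"
proof -
  have "{r. \<not> E r} = space (measure_pmf M) - {r. E r}" by auto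
  then show ?thesis by (simp only: measure_pmf.prob_compl sets_measure_pmf UNIV_I Pow_UNIV)
qed

lemma prob_disj_le:
  "measure_pmf.prob M {r. E r \<or> F r} \<le> measure_pmf.prob M {r. E r} + measure_pmf.prob M {r. F r}"
  unfolding Collect_disj_eq by (rule measure_Un_le) simp_all

lemma prob_bex_le:
  assumes "finite X"
  shows "measure_pmf.prob M {r. \<exists>x\<in>X. E x r} \<le> (\<Sum>x\<in>X. measure_pmf.prob M {r. E x r})"
proof -
  have "{r. \<exists>x\<in>X. E x r} = (\<Union>x\<in>X. {r. E x r})" by auto
  then show ?thesis
    using assms by (simp add: measure_pmf.finite_measure_subadditive_finite)
qed

text \<open>Splitting the product measure into its parts on \<open>S\<close> and on
  \<open>I - S\<close> makes the event a rectangle, since \<open>F\<close> never looks at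
  \<open>S\<close>. The two marginals come from the same identity with one event replaced by
  \<open>True\<close>.\<close>

lemma prob_conj_indep:
  fixes \<mu> :: "'a \<Rightarrow> 'b pmf" and d :: 'b
  assumes fin: "finite I" and S: "S \<subseteq> I" "S \<inter> T = {}"
    and E: "depends_on S E" and F: "depends_on T F"
  defines "M \<equiv> Pi_pmf I d \<mu>"
  shows "measure_pmf.prob M {r. E r \<and> F r} = measure_pmf.prob M {r. E r} * measure_pmf.prob M {r. F r}"
proof -
  let ?M1 = "Pi_pmf S d \<mu>" and ?M2 = "Pi_pmf (I - S) d \<mu>"
  have *: "measure_pmf.prob M {r. E' r \<and> F' r}
      = measure_pmf.prob ?M1 {r. E' r} * measure_pmf.prob ?M2 {r. F' r}"
    if E': "depends_on S E'" and F': "depends_on T F'" for E' F'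
  proof -
    let ?h = "\<lambda>(f, g) x. if x \<in> S then f x else g x"
    have "M = Pi_pmf (S \<union> (I - S)) d \<mu>"
      using S by (simp add: M_def Un_absorb1)
    also have "\<dots> = map_pmf ?h (pair_pmf ?M1 ?M2)"
      using fin S by (intro Pi_pmf_union) (auto intro: finite_subset)
    finally have "measure_pmf.prob M {r. E' r \<and> F' r}
        = measure_pmf.prob (pair_pmf ?M1 ?M2) (?h -` {r. E' r \<and> F' r})"
      by simp
    also have "?h -` {r. E' r \<and> F' r} = {r. E' r} \<times> {r. F' r}"
    proof -
      have "E' (?h (f, g)) = E' f" "F' (?h (f, g)) = F' g" for f g
        using S by (auto intro!: depends_onD[OF E'] depends_onD[OF F'])
      then show ?thesis by auto
    qed
    finally show ?thesis by (simp add: prob_pair_pmf_Times)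
  qed
  have True_dep: "depends_on S (\<lambda>_. True)" "depends_on T (\<lambda>_. True)"
    by (simp_all add: depends_on_def)
  show ?thesis
    using *[OF E F] *[OF E True_dep(2)] *[OF True_dep(1) F] by simp
qed

lemma prob_all_le:
  fixes \<mu> :: "'a \<Rightarrow> 'b pmf" and d :: 'b
  assumes fin: "finite I" and J: "finite J"
    and S: "\<And>j. j \<in> J \<Longrightarrow> S j \<subseteq> I" "disjoint_family_on S J"
    and E: "\<And>j. j \<in> J \<Longrightarrow> depends_on (S j) (E j)"
    and le: "\<And>j. j \<in> J \<Longrightarrow> measure_pmf.prob (Pi_pmf I d \<mu>) {r. E j r} \<le> c"
  shows "measure_pmf.prob (Pi_pmf I d \<mu>) {r. \<forall>j\<in>J. E j r} \<le> c ^ card J"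
  using J S E le
proof (induction J rule: finite_induct)
  case (insert k J)
  let ?P = "measure_pmf.prob (Pi_pmf I d \<mu>)"
  have dep: "depends_on (\<Union>(S ` J)) (\<lambda>r. \<forall>j\<in>J. E j r)"
  proof (rule depends_onI)
    fix f g :: "'a \<Rightarrow> 'b"
    assume "\<And>i. i \<in> \<Union>(S ` J) \<Longrightarrow> f i = g i"
    then have "E j f = E j g" if "j \<in> J" for j
      using that by (intro depends_onD[OF insert.prems(3)]) auto
    then show "(\<forall>j\<in>J. E j f) = (\<forall>j\<in>J. E j g)" by simp
  qed
  have disj: "S k \<inter> \<Union>(S ` J) = {}"
    using insert.prems(2) insert.hyps by (auto simp: disjoint_family_on_def)
  have IH: "?P {r. \<forall>j\<in>J. E j r} \<le> c ^ card J"
    using insert.prems by (intro insert.IH) (auto simp: disjoint_family_on_def)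
  have "0 \<le> c"
    using insert.prems(4)[of k] measure_nonneg[of _ "{r. E k r}"] by (meson insertI1 order_trans)
  have "?P {r. \<forall>j\<in>insert k J. E j r} = ?P {r. E k r \<and> (\<forall>j\<in>J. E j r)}"
    by simp
  also have "\<dots> = ?P {r. E k r} * ?P {r. \<forall>j\<in>J. E j r}"
    using insert.prems by (intro prob_conj_indep[OF fin _ disj _ dep]) auto
  also have "\<dots> \<le> c * c ^ card J"
    using IH insert.prems(4) \<open>0 \<le> c\<close> by (intro mult_mono) auto
  finally show ?case using insert.hyps by simp
qed simp

text \<open>Law of total probability over the values of \<open>X\<close>: each \<open>E b\<close> is
  independent of \<open>X r = b\<close>, so a bound uniform in the fixed parameter \<open>b\<close>
  survives when \<open>b\<close> becomes the random \<open>X r\<close>.\<close>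

lemma prob_depending_le:
  fixes \<mu> :: "'a \<Rightarrow> 'b pmf" and d :: 'b
  assumes fin: "finite I" and S: "S \<subseteq> I" "S \<inter> T = {}"
    and X: "depends_on S X" "finite (range X)"
    and E: "\<And>b. b \<in> range X \<Longrightarrow> depends_on T (E b)"
    and le: "\<And>b. b \<in> range X \<Longrightarrow> measure_pmf.prob (Pi_pmf I d \<mu>) {r. E b r} \<le> c"
  shows "measure_pmf.prob (Pi_pmf I d \<mu>) {r. E (X r) r} \<le> c"
proof -
  let ?P = "measure_pmf.prob (Pi_pmf I d \<mu>)"
  have X_dep: "depends_on S (\<lambda>r. X r = b)" for b
  proof (rule depends_onI)
    fix f g :: "'a \<Rightarrow> 'b"
    assume "\<And>i. i \<in> S \<Longrightarrow> f i = g i"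
    then have "X f = X g" by (rule depends_onD[OF X(1)])
    then show "(X f = b) = (X g = b)" by simp
  qed
  have disj: "disjoint_family_on (\<lambda>b. {r. X r = b \<and> E b r}) (range X)"
       "disjoint_family_on (\<lambda>b. {r. X r = b}) (range X)"
    by (auto simp: disjoint_family_on_def)
  have "?P {r. E (X r) r} = ?P (\<Union>b\<in>range X. {r. X r = b \<and> E b r})"
    by (rule arg_cong[where f = ?P]) auto
  also have "\<dots> = (\<Sum>b\<in>range X. ?P {r. X r = b \<and> E b r})"
    using X(2) disj by (intro measure_pmf.finite_measure_finite_Union) auto
  also have "\<dots> = (\<Sum>b\<in>range X. ?P {r. X r = b} * ?P {r. E b r})"
    using E by (intro sum.cong refl prob_conj_indep[OF fin S X_dep]) auto
  also have "\<dots> \<le> (\<Sum>b\<in>range X. ?P {r. X r = b} * c)"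
    using le by (intro sum_mono mult_left_mono) auto
  also have "\<dots> = (\<Sum>b\<in>range X. ?P {r. X r = b}) * c"
    by (simp add: sum_distrib_right)
  also have "(\<Sum>b\<in>range X. ?P {r. X r = b}) = ?P (\<Union>b\<in>range X. {r. X r = b})"
    using X(2) disj by (intro measure_pmf.finite_measure_finite_Union[symmetric]) auto
  also have "(\<Union>b\<in>range X. {r. X r = b}) = UNIV"
    by auto
  finally show ?thesis by simp
qed

lemma prob_Pi_bernoulli_all:
  assumes fin: "finite I" and J: "J \<subseteq> I" and p: "0 \<le> p" "p \<le> 1"
  shows "measure_pmf.prob (Pi_pmf I False (\<lambda>_. bernoulli_pmf p)) {r. \<forall>e\<in>J. r e} = p ^ card J"
    and "measure_pmf.prob (Pi_pmf I False (\<lambda>_. bernoulli_pmf p)) {r. \<forall>e\<in>J. \<not> r e} = (1 - p) ^ card J"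
proof -
  have *: "measure_pmf.prob (Pi_pmf I False (\<lambda>_. bernoulli_pmf p)) {r. \<forall>e\<in>J. r e = b}
      = pmf (bernoulli_pmf p) b ^ card J" for b
  proof -
    have "{r. \<forall>e\<in>J. r e = b} = Pi I (\<lambda>e. if e \<in> J then {b} else UNIV)"
      using J by (auto simp: Pi_def split: if_splits)
    then have "measure_pmf.prob (Pi_pmf I False (\<lambda>_. bernoulli_pmf p)) {r. \<forall>e\<in>J. r e = b}
        = (\<Prod>e\<in>I. measure_pmf.prob (bernoulli_pmf p) (if e \<in> J then {b} else UNIV))"
      using fin by (simp add: measure_Pi_pmf_Pi)
    also have "\<dots> = (\<Prod>e\<in>J. pmf (bernoulli_pmf p) b)"
      using fin J by (intro prod.mono_neutral_cong_right) (auto simp: measure_pmf_single)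
    finally show ?thesis by simp
  qed
  show "measure_pmf.prob (Pi_pmf I False (\<lambda>_. bernoulli_pmf p)) {r. \<forall>e\<in>J. r e} = p ^ card J"
    using *[of True] p by simp
  show "measure_pmf.prob (Pi_pmf I False (\<lambda>_. bernoulli_pmf p)) {r. \<forall>e\<in>J. \<not> r e} = (1 - p) ^ card J"
    using *[of False] p by simp
qed

section \<open>Two-step searches through independent intermediate vertices\<close>

text \<open>An intermediate \<open>z\<close> works if \<open>r\<close> is false at
  \<open>e z\<close> and true at some \<open>g z a\<close>, which has probability
  \<open>(1 - p) * (1 - (1 - p) ^ card B)\<close>. Different \<open>z\<close> use disjoint
  coordinates, so the failures multiply. Abstract \<open>e\<close> and \<open>g\<close> let one
  lemma serve both directions of search.\<close>

lemma prob_no_two_step_le: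
  assumes fin: "finite I" "finite Z" "finite B" and p: "0 \<le> p" "p \<le> 1"
    and e: "inj_on e Z" "e ` Z \<subseteq> I"
    and g: "inj_on (case_prod g) (Z \<times> B)" "case_prod g ` (Z \<times> B) \<subseteq> I"
    and eg: "e ` Z \<inter> case_prod g ` (Z \<times> B) = {}"
  shows "measure_pmf.prob (Pi_pmf I False (\<lambda>_. bernoulli_pmf p)) {r. \<forall>z\<in>Z. r (e z) \<or> (\<forall>a\<in>B. \<not> r (g z a))}
     \<le> (1 - (1 - p) * (1 - (1 - p) ^ card B)) ^ card Z"
proof -
  let ?P = "measure_pmf.prob (Pi_pmf I False (\<lambda>_. bernoulli_pmf p))"
  let ?S = "\<lambda>z. insert (e z) (g z ` B)"
  have SI: "?S z \<subseteq> I" if "z \<in> Z" for z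
    using that e g by fastforce
  have eg': "e y \<noteq> g y' a" if "y \<in> Z" "y' \<in> Z" "a \<in> B" for y y' a
    using eg that by force
  have disj: "disjoint_family_on ?S Z"
  proof (unfold disjoint_family_on_def, intro ballI impI)
    fix z z' assume z: "z \<in> Z" "z' \<in> Z" "z \<noteq> z'"
    have "e z \<noteq> e z'" using z e by (auto dest: inj_onD)
    moreover note eg'
    moreover have "g z a \<noteq> g z' a'" if "a \<in> B" "a' \<in> B" for a a'
      using inj_onD[OF g(1), of "(z, a)" "(z', a')"] z that by auto
    ultimately show "?S z \<inter> ?S z' = {}" using z by auto
  qed
  have single: "?P {r. r (e z) \<or> (\<forall>a\<in>B. \<not> r (g z a))} = 1 - (1 - p) * (1 - (1 - p) ^ card B)"
    if z: "z \<in> Z" for z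
  proof -
    have card: "card (g z ` B) = card B"
      using g(1) z by (intro card_image) (auto simp: inj_on_def)
    have "?P {r. \<not> (r (e z) \<or> (\<forall>a\<in>B. \<not> r (g z a)))}
        = ?P {r. \<not> r (e z) \<and> \<not> (\<forall>a\<in>B. \<not> r (g z a))}"
      by simp
    also have "\<dots> = ?P {r. \<not> r (e z)} * ?P {r. \<not> (\<forall>a\<in>B. \<not> r (g z a))}"
      using z SI eg' by (intro prob_conj_indep[where S = "{e z}" and T = "g z ` B"] fin)
        (auto intro!: depends_onI)
    also have "?P {r. \<not> r (e z)} = 1 - p"
      using prob_Pi_bernoulli_all(2)[OF fin(1), of "{e z}" p] z SI p by simp
    also have "?P {r. \<not> (\<forall>a\<in>B. \<not> r (g z a))} = 1 - (1 - p) ^ card B"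
    proof -
      have "?P {r. \<forall>a\<in>B. \<not> r (g z a)} = (1 - p) ^ card B"
        using prob_Pi_bernoulli_all(2)[OF fin(1), of "g z ` B" p] z SI p card by simp
      then show ?thesis by (simp only: prob_neg)
    qed
    finally show ?thesis by (simp only: prob_neg)
  qed
  show ?thesis
    using SI disj single
    by (intro prob_all_le[where S = ?S] fin) (auto intro!: depends_onI)
qed

lemma card_le_of_disjoint_hits:
  assumes "finite N" and "disjoint_family_on B {..<s}" and "\<And>i. i < s \<Longrightarrow> N \<inter> B i \<noteq> {}"
  shows "s \<le> card N"
proof -
  from assms(3) have "\<forall>i. \<exists>a. i < s \<longrightarrow> a \<in> N \<inter> B i" by blast
  then obtain h where h: "\<And>i. i < s \<Longrightarrow> h i \<in> N \<inter> B i" by metis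
  have "inj_on h {..<s}"
  proof (rule inj_onI, rule ccontr)
    fix i j assume *: "i \<in> {..<s}" "j \<in> {..<s}" "h i = h j" "i \<noteq> j"
    then have "B i \<inter> B j = {}" using assms(2) by (simp add: disjoint_family_on_def)
    then show False using h[of i] h[of j] * by auto
  qed
  then have "card {..<s} \<le> card N"
    using h assms(1) by (intro card_inj_on_le) auto
  then show ?thesis by simp
qed

text \<open>If fewer than \<open>s\<close> elements are reached, then one of \<open>s\<close>
  disjoint parts of \<open>A\<close> of size \<open>d\<close> is missed entirely; the union bound
  over the parts gives the factor \<open>s\<close>.\<close>

lemma prob_few_two_step_le:
  assumes fin: "finite I" "finite Z" "finite A" and p: "0 \<le> p" "p \<le> 1"
    and e: "inj_on e Z" "e ` Z \<subseteq> I"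
    and g: "inj_on (case_prod g) (Z \<times> A)" "case_prod g ` (Z \<times> A) \<subseteq> I"
    and eg: "e ` Z \<inter> case_prod g ` (Z \<times> A) = {}"
    and sd: "s * d \<le> card A"
  shows "measure_pmf.prob (Pi_pmf I False (\<lambda>_. bernoulli_pmf p))
      {r. card {a\<in>A. \<exists>z\<in>Z. \<not> r (e z) \<and> r (g z a)} < s}
     \<le> real s * (1 - (1 - p) * (1 - (1 - p) ^ d)) ^ card Z"
proof -
  let ?P = "measure_pmf.prob (Pi_pmf I False (\<lambda>_. bernoulli_pmf p))"
  obtain h where h: "bij_betw h {0..<card A} A"
    using ex_bij_betw_nat_finite[OF fin(3)] by blast
  \<comment> \<open>\<open>B i\<close> is the stretch number \<open>i\<close> of length
    \<open>d\<close> in an enumeration of \<open>A\<close>; the elements from position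
    \<open>s * d\<close> on are left over.\<close>
  define B where "B i = h ` {i * d..<Suc i * d}" for i
  have sub: "{i * d..<Suc i * d} \<subseteq> {0..<card A}" if "i < s" for i
  proof -
    have "Suc i * d \<le> s * d" using that by (intro mult_right_mono) auto
    with sd show ?thesis by auto
  qed
  have BA: "B i \<subseteq> A" if "i < s" for i
    using sub[OF that] h unfolding B_def bij_betw_def by blast
  have cardB: "card (B i) = d" if "i < s" for i
    using sub[OF that] h unfolding B_def bij_betw_def
    by (subst card_image) (auto intro: inj_on_subset)
  have disj: "disjoint_family_on B {..<s}"
  proof (unfold disjoint_family_on_def, intro ballI impI)
    have less: "B i \<inter> B j = {}" if "i < j" "j < s" for i j
    proof -
      have "Suc i * d \<le> j * d" using that by (intro mult_right_mono) auto
      then have "{i * d..<Suc i * d} \<inter> {j * d..<Suc j * d} = {}" by auto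
      moreover have "inj_on h {0..<card A}" using h by (simp add: bij_betw_def)
      ultimately show ?thesis
        using sub[of i] sub[of j] that unfolding B_def
        by (subst inj_on_image_Int[symmetric, of h "{0..<card A}"]) auto
    qed
    fix i j assume "i \<in> {..<s}" "j \<in> {..<s}" "i \<noteq> j"
    then show "B i \<inter> B j = {}"
      using less[of i j] less[of j i] by (cases i j rule: linorder_cases) auto
  qed
  have "?P {r. card {a\<in>A. \<exists>z\<in>Z. \<not> r (e z) \<and> r (g z a)} < s}
      \<le> ?P (\<Union>i<s. {r. \<forall>z\<in>Z. r (e z) \<or> (\<forall>a\<in>B i. \<not> r (g z a))})"
  proof (intro measure_pmf.finite_measure_mono subsetI)
    fix r assume r: "r \<in> {r. card {a\<in>A. \<exists>z\<in>Z. \<not> r (e z) \<and> r (g z a)} < s}"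
    let ?N = "{a\<in>A. \<exists>z\<in>Z. \<not> r (e z) \<and> r (g z a)}"
    have "\<exists>i<s. ?N \<inter> B i = {}"
    proof (rule ccontr)
      assume "\<not> ?thesis"
      then have "s \<le> card ?N"
        using fin(3) disj by (intro card_le_of_disjoint_hits[of _ B]) auto
      with r show False by simp
    qed
    then show "r \<in> (\<Union>i<s. {r. \<forall>z\<in>Z. r (e z) \<or> (\<forall>a\<in>B i. \<not> r (g z a))})"
      using BA by blast
  qed simp
  also have "\<dots> \<le> (\<Sum>i<s. ?P {r. \<forall>z\<in>Z. r (e z) \<or> (\<forall>a\<in>B i. \<not> r (g z a))})"
    by (intro measure_pmf.finite_measure_subadditive_finite) auto
  also have "\<dots> \<le> (\<Sum>i<s. (1 - (1 - p) * (1 - (1 - p) ^ d)) ^ card Z)"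
  proof (intro sum_mono)
    fix i assume "i \<in> {..<s}"
    then have i: "i < s" by simp
    have sub: "Z \<times> B i \<subseteq> Z \<times> A" using BA[OF i] by auto
    have finB: "finite (B i)" using BA[OF i] fin(3) finite_subset by blast
    show "?P {r. \<forall>z\<in>Z. r (e z) \<or> (\<forall>a\<in>B i. \<not> r (g z a))} \<le> (1 - (1 - p) * (1 - (1 - p) ^ d)) ^ card Z"
      unfolding cardB[OF i, symmetric]
      by (intro prob_no_two_step_le fin finB p e inj_on_subset[OF g(1) sub])
         (use sub g(2) eg in blast)+
  qed
  finally show ?thesis by simp
qed

subsection \<open>Walks of bounded length\<close>

text \<open>Each round of \<open>awalk_to_apath\<close> deletes a cycle, replacing
  \<open>q @ r @ s\<close> by \<open>q @ s\<close>.\<close>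

lemma (in wf_digraph) length_awalk_to_apath_le:
  assumes "awalk u p v"
  shows "length (awalk_to_apath p) \<le> length p"
  using assms
proof (induct rule: awalk_to_apath_induct)
  case (path p)
  then have "awalk_to_apath p = p"
    by (auto simp: awalk_to_apath.simps)
  then show ?case by simp
next
  case (decomp p q r s)
  then have "awalk_to_apath p = awalk_to_apath (q @ s)"
    using step_awalk_to_apath by blast
  moreover have "p = q @ r @ s"
    using decomp by (auto elim: awalk_cyc_decompE)
  ultimately show ?case using decomp(4) by simp
qed

lemma (in pair_wf_digraph) relpow_imp_awalk:
  assumes "x \<in> pverts G" and "(x, y) \<in> parcs G ^^ j"
  shows "\<exists>P. awalk x P y \<and> length P = j"
  using assms
proof (induction j arbitrary: x)
  case 0
  show ?case
    using 0 by (intro exI[of _ "[]"]) (simp add: awalk_Nil_iff)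
next
  case (Suc j)
  obtain z where z: "(x, z) \<in> parcs G" "(z, y) \<in> parcs G ^^ j"
    by (rule relpow_Suc_E2[OF Suc.prems(2)])
  obtain P where P: "awalk z P y" "length P = j"
    using Suc.IH[OF in_arcsD2[OF z(1)] z(2)] by (elim exE conjE)
  show ?case
    using z(1) P by (intro exI[of _ "(x, z) # P"]) (simp add: awalk_Cons_iff)
qed

text \<open>\<open>king\<close> asks for paths without repeated vertices; this allows all later
  arguments to use powers of the arc relation.\<close>

lemma (in pair_wf_digraph) relpow_imp_apath:
  assumes "x \<in> pverts G" and "(x, y) \<in> parcs G ^^ j"
  shows "\<exists>P. apath x P y \<and> length P \<le> j"
proof -
  obtain P where P: "awalk x P y" "length P = j"
    using relpow_imp_awalk[OF assms] by (elim exE conjE)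
  show ?thesis
    using apath_awalk_to_apath[OF P(1)] length_awalk_to_apath_le[OF P(1)] P(2)
    by (intro exI[of _ "awalk_to_apath P"]) simp
qed

subsection \<open>Asymptotic estimates\<close>

lemma one_minus_power_le_exp:
  fixes p :: real
  assumes "0 \<le> p" "p \<le> 1"
  shows "(1 - p) ^ d \<le> exp (- (p * real d))"
proof -
  have "(1 - p) ^ d \<le> exp (- p) ^ d"
    using assms exp_ge_add_one_self[of "- p"] by (intro power_mono) auto
  also have "\<dots> = exp (- (p * real d))"
    by (simp add: exp_of_nat_mult[symmetric] mult.commute)
  finally show ?thesis .
qed

text \<open>Since \<open>p * d\<close> is at least \<open>1 / s\<close>, a part of size
  \<open>d\<close> is hit from a given intermediate vertex with probability at least
  \<open>1 / (2 * s)\<close>, and the first arc costs another factor \<open>1 / 2\<close>. So each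
  of the \<open>k\<close> trials succeeds with probability at least \<open>1 / (4 * s)\<close>, and
  \<open>k\<close> is at least the square of \<open>s\<close>.\<close>

lemma two_step_miss_le_exp:
  fixes p :: real
  assumes p: "0 \<le> p" "p \<le> 1 / 2" and s: "1 \<le> s" "s\<^sup>2 \<le> k" and pd: "1 \<le> p * real d * real s"
  shows "(1 - (1 - p) * (1 - (1 - p) ^ d)) ^ k \<le> exp (- real s / 4)"
proof -
  have s_pos: "real s \<ge> 1" using s by simp
  have "(1 - p) ^ d \<le> exp (- (p * real d))"
    using p by (intro one_minus_power_le_exp) auto
  also have "\<dots> = 1 / exp (p * real d)"
    by (simp add: exp_minus field_simps)
  also have "\<dots> \<le> 1 / (1 + p * real d)"
    using p exp_ge_add_one_self[of "p * real d"] by (intro divide_left_mono) (auto intro!: mult_pos_pos add_pos_nonneg)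
  also have "\<dots> \<le> 1 - 1 / (2 * real s)"
  proof -
    have "1 / real s \<le> p * real d" using pd s_pos by (simp add: field_simps)
    then have "1 / (1 + p * real d) \<le> 1 / (1 + 1 / real s)"
      using s_pos p by (intro divide_left_mono) (auto intro!: mult_pos_pos add_pos_nonneg)
    also have "\<dots> \<le> 1 - 1 / (2 * real s)"
      using s_pos by (simp add: field_simps)
    finally show ?thesis .
  qed
  finally have *: "1 / (2 * real s) \<le> 1 - (1 - p) ^ d" by simp
  have "(1 / 2) * (1 / (2 * real s)) \<le> (1 - p) * (1 - (1 - p) ^ d)"
    using p s_pos * by (intro mult_mono) auto
  then have le: "1 - (1 - p) * (1 - (1 - p) ^ d) \<le> 1 - 1 / (4 * real s)" by simp
  \<comment> \<open>Makes the base of the power nonnegative, as monotonicity of powers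
    requires.\<close>
  have "(1 - p) * (1 - (1 - p) ^ d) \<le> 1 * 1"
    using p by (intro mult_mono) (auto simp: power_le_one)
  then have "(1 - (1 - p) * (1 - (1 - p) ^ d)) ^ k \<le> (1 - 1 / (4 * real s)) ^ k"
    using le by (intro power_mono) auto
  also have "\<dots> \<le> exp (- (1 / (4 * real s) * real k))"
    using s_pos by (intro one_minus_power_le_exp) auto
  also have "\<dots> \<le> exp (- real s / 4)"
  proof -
    have "real s * real s \<le> real k"
      using s(2) by (metis of_nat_mono of_nat_mult power2_eq_square)
    then show ?thesis using s_pos by (simp add: field_simps)
  qed
  finally show ?thesis .
qed

section \<open>The error of a search with \<open>k\<close> intermediate vertices\<close>

definition two_step_err :: "nat \<Rightarrow> real" where
  "two_step_err k = real (floor_sqrt k) * exp (- real (floor_sqrt k) / 4)"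

lemma two_step_err_nonneg: "0 \<le> two_step_err k"
  by (simp add: two_step_err_def)

lemma filterlim_floor_sqrt: "filterlim floor_sqrt at_top sequentially"
  unfolding filterlim_at_top eventually_sequentially
  by (metis le_floor_sqrt_iff)

text \<open>With \<open>s = floor_sqrt k\<close>, \<open>k\<close> is at most the square of
  \<open>s + 1\<close>; the exponential beats the fourth power of \<open>s + 1\<close>, which bounds
  the square of \<open>k\<close>.\<close>

lemma two_step_err_le_inverse_square: "eventually (\<lambda>k. two_step_err k \<le> 1 / (real k)\<^sup>2) sequentially"
proof -
  have "eventually (\<lambda>s::nat. real s * exp (- real s / 4) * (real s + 1) ^ 4 \<le> 1) sequentially"
    by real_asymp
  then have "eventually (\<lambda>k. two_step_err k * (real (floor_sqrt k) + 1) ^ 4 \<le> 1) sequentially"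
    unfolding two_step_err_def using filterlim_floor_sqrt by (rule eventually_compose_filterlim)
  then show ?thesis
    using eventually_gt_at_top[of 0]
  proof eventually_elim
    case (elim k)
    have "k \<le> (Suc (floor_sqrt k))\<^sup>2"
      using Suc_floor_sqrt_power2_gt[of k] by simp
    then have "real k \<le> real ((Suc (floor_sqrt k))\<^sup>2)" by (rule of_nat_mono)
    also have "\<dots> = (real (floor_sqrt k) + 1)\<^sup>2" by (simp add: add.commute)
    finally have "(real k)\<^sup>2 \<le> ((real (floor_sqrt k) + 1)\<^sup>2)\<^sup>2" by (intro power_mono) auto
    also have "\<dots> = (real (floor_sqrt k) + 1) ^ 4" by (simp flip: power_mult)
    finally have "two_step_err k * (real k)\<^sup>2 \<le> two_step_err k * (real (floor_sqrt k) + 1) ^ 4"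
      by (intro mult_left_mono two_step_err_nonneg)
    with elim show ?case by (simp add: field_simps)
  qed
qed

lemma summable_two_step_err: "summable two_step_err"
proof (rule summable_comparison_test_ev)
  show "eventually (\<lambda>k. norm (two_step_err k) \<le> inverse (real k ^ 2)) sequentially"
    using two_step_err_le_inverse_square by eventually_elim (simp add: two_step_err_nonneg field_simps)
  show "summable (\<lambda>k. inverse (real k ^ 2))"
    by (rule inverse_power_summable) simp
qed

text \<open>For \<open>s\<close> and \<open>t\<close> at least 2, \<open>s + t <= s * t\<close>.
  This splits the bound into one factor per endpoint, so that its double sum becomes a product of
  two sums. The lower bound 4 on \<open>k\<close> and \<open>l\<close> provides the two square
  roots.\<close>

lemma half_power_le_two_step_err:
  assumes "4 \<le> k" "4 \<le> l"
  shows "(1 / 2) ^ (floor_sqrt k * floor_sqrt l) \<le> two_step_err k * two_step_err l"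
proof -
  have ge2: "2 \<le> floor_sqrt k" if "4 \<le> k" for k
    using that by (intro le_floor_sqrtI) simp
  have half: "(1 / 2) ^ floor_sqrt k \<le> two_step_err k" if "4 \<le> k" for k
  proof -
    \<comment> \<open>Here \<open>1 / 2 <= 3 / 4 <= exp (- 1 / 4)\<close>.\<close>
    have "(1 / 2 :: real) ^ floor_sqrt k \<le> exp (- 1 / 4) ^ floor_sqrt k"
      using exp_ge_add_one_self[of "- 1 / 4"] by (intro power_mono) auto
    also have "\<dots> = exp (- real (floor_sqrt k) / 4)"
      by (simp add: exp_of_nat_mult[symmetric])
    also have "\<dots> \<le> two_step_err k"
      using ge2[OF that] by (simp add: two_step_err_def)
    finally show ?thesis .
  qed
  have "floor_sqrt k + floor_sqrt l \<le> floor_sqrt k * floor_sqrt l"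
  proof -
    obtain a b where "floor_sqrt k = a + 2" "floor_sqrt l = b + 2"
      using ge2[OF assms(1)] ge2[OF assms(2)] by (metis le_add_diff_inverse2)
    then show ?thesis by simp
  qed
  then have "(1 / 2 :: real) ^ (floor_sqrt k * floor_sqrt l) \<le> (1 / 2) ^ (floor_sqrt k + floor_sqrt l)"
    by (intro power_decreasing) auto
  also have "\<dots> = (1 / 2) ^ floor_sqrt k * (1 / 2) ^ floor_sqrt l"
    by (simp add: power_add)
  also have "\<dots> \<le> two_step_err k * two_step_err l"
    using half assms two_step_err_nonneg by (intro mult_mono) auto
  finally show ?thesis .
qed

lemma filterlim_div5: "filterlim (\<lambda>n::nat. n div 5) at_top sequentially"
  unfolding filterlim_at_top eventually_sequentially
proof
  fix Z :: nat
  show "\<exists>N. \<forall>n\<ge>N. Z \<le> n div 5"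
    by (intro exI[of _ "5 * Z"]) auto
qed

text \<open>The terms with \<open>k < q\<close> lie in a tail of a convergent series. The others all
  equal \<open>two_step_err q\<close>, at most the inverse square of \<open>q\<close>, and number at
  most \<open>10 * q\<close>, so they contribute at most \<open>10 / q\<close>. Only the tail
  determines \<open>K\<close>, which therefore does not depend on \<open>n\<close>.\<close>

lemma eventually_sum_two_step_err_less:
  assumes "0 < \<epsilon>"
  obtains K where "4 \<le> K"
    "eventually (\<lambda>n. (\<Sum>k = K..<n - 2 * (n div 5). two_step_err (min k (n div 5))) < \<epsilon>) sequentially"
proof -
  obtain K0 where K0: "\<And>m n. m \<ge> K0 \<Longrightarrow> norm (sum two_step_err {m..<n}) < \<epsilon> / 2"
    using summable_two_step_err assms unfolding summable_Cauchy by (meson half_gt_zero)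
  define K where "K = max 4 K0"
  have "(\<lambda>n. 10 / real (n div 5)) \<longlonglongrightarrow> 0"
    by (rule filterlim_compose[OF _ filterlim_div5]) real_asymp
  then have "eventually (\<lambda>n. 10 / real (n div 5) < \<epsilon> / 2) sequentially"
    using assms by (intro order_tendstoD) auto
  moreover have "eventually (\<lambda>n. two_step_err (n div 5) \<le> 1 / (real (n div 5))\<^sup>2) sequentially"
    using two_step_err_le_inverse_square filterlim_div5 by (rule eventually_compose_filterlim)
  moreover have "eventually (\<lambda>n::nat. 5 \<le> n) sequentially"
    by (rule eventually_ge_at_top)
  ultimately have "eventually (\<lambda>n. (\<Sum>k = K..<n - 2 * (n div 5). two_step_err (min k (n div 5))) < \<epsilon>) sequentially"
  proof eventually_elim
    case (elim n)
    define q where "q = n div 5"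
    have q: "1 \<le> q" "n \<le> 10 * q" using elim(3) unfolding q_def by presburger+
    have "(\<Sum>k = K..<n - 2 * q. two_step_err (min k q))
        \<le> (\<Sum>k = K..<n - 2 * q. (if k < q then two_step_err k else 0) + two_step_err q)"
      by (intro sum_mono) (auto simp: two_step_err_nonneg min_def)
    also have "\<dots> = (\<Sum>k = K..<n - 2 * q. if k < q then two_step_err k else 0) + real (n - 2 * q - K) * two_step_err q"
      by (simp add: sum.distrib)
    also have "(\<Sum>k = K..<n - 2 * q. if k < q then two_step_err k else 0) \<le> sum two_step_err {K..<q}"
      by (subst sum.inter_filter[symmetric]) (auto intro!: sum_mono2 two_step_err_nonneg)
    also have "\<dots> < \<epsilon> / 2"
      using K0[of K q] by (simp add: K_def)
    also have "real (n - 2 * q - K) * two_step_err q \<le> (10 * real q) * (1 / (real q)\<^sup>2)"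
      using q elim(2) by (intro mult_mono) (auto simp: q_def two_step_err_nonneg)
    also have "\<dots> = 10 / real q"
      using q by (simp add: power2_eq_square)
    also have "\<dots> < \<epsilon> / 2" using elim(1) by (simp add: q_def)
    finally show ?case by (simp add: q_def)
  qed
  then show ?thesis by (intro that[of K]) (simp_all add: K_def)
qed

lemma filterlim_div5_mult:
  fixes p :: "nat \<Rightarrow> real"
  assumes "\<And>n. n \<ge> 1 \<Longrightarrow> 0 \<le> p n" and "filterlim (\<lambda>n. real n * p n) at_top sequentially"
  shows "filterlim (\<lambda>n. p n * real (n div 5)) at_top sequentially"
proof (rule filterlim_at_top_mono)
  show "filterlim (\<lambda>n. (1 / 10) * (real n * p n)) at_top sequentially"
    using assms(2) by (intro filterlim_tendsto_pos_mult_at_top[OF tendsto_const]) auto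
  show "eventually (\<lambda>n. (1 / 10) * (real n * p n) \<le> p n * real (n div 5)) sequentially"
    using eventually_ge_at_top[of 5]
  proof eventually_elim
    case (elim n)
    then have "n \<le> 10 * (n div 5)" by presburger
    then have "real n \<le> 10 * real (n div 5)" by linarith
    then show ?case using mult_left_mono[of "real n" "10 * real (n div 5)" "p n"] assms(1)[of n] elim
      by (simp add: mult.commute)
  qed
qed

text \<open>The first two terms are polynomial times exponential in \<open>n div 5\<close>, as
  \<open>n <= 5 * (n div 5) + 4\<close>. The third is governed by \<open>exp (- p * q)\<close> with
  \<open>q = n div 5\<close>, and \<open>K\<close> stays fixed.\<close>

lemma small_terms_tendsto_0:
  fixes p :: "nat \<Rightarrow> real"
  assumes p: "\<And>n. n \<ge> 1 \<Longrightarrow> 0 \<le> p n \<and> p n \<le> 1 / 2"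
    and lim: "filterlim (\<lambda>n. real n * p n) at_top sequentially"
  shows "(\<lambda>n. (real n)\<^sup>2 * (3 / 4) ^ (n div 5) + 2 * (real n * (1 / 2) ^ (n div 5))
             + 2 * (real K * (1 - p n) ^ (n div 5))) \<longlonglongrightarrow> 0"
proof -
  have n_le: "real n \<le> 5 * real (n div 5) + 4" for n by linarith
  have 1: "(\<lambda>n. (real n)\<^sup>2 * (3 / 4) ^ (n div 5)) \<longlonglongrightarrow> 0"
  proof (rule tendsto_sandwich[where f = "\<lambda>_. 0"])
    show "(\<lambda>n. (5 * real (n div 5) + 4)\<^sup>2 * (3 / 4) ^ (n div 5)) \<longlonglongrightarrow> 0"
      by (rule filterlim_compose[OF _ filterlim_div5]) real_asymp
    show "eventually (\<lambda>n. (real n)\<^sup>2 * (3 / 4) ^ (n div 5)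
        \<le> (5 * real (n div 5) + 4)\<^sup>2 * (3 / 4) ^ (n div 5)) sequentially"
      using n_le by (intro always_eventually allI mult_right_mono power_mono) auto
  qed auto
  have 2: "(\<lambda>n. real n * (1 / 2) ^ (n div 5)) \<longlonglongrightarrow> 0"
  proof (rule tendsto_sandwich[where f = "\<lambda>_. 0"])
    show "(\<lambda>n. (5 * real (n div 5) + 4) * (1 / 2) ^ (n div 5)) \<longlonglongrightarrow> 0"
      by (rule filterlim_compose[OF _ filterlim_div5]) real_asymp
    show "eventually (\<lambda>n. real n * (1 / 2) ^ (n div 5)
        \<le> (5 * real (n div 5) + 4) * (1 / 2) ^ (n div 5)) sequentially"
      using n_le by (intro always_eventually allI mult_right_mono) auto
  qed auto
  have 3: "(\<lambda>n. (1 - p n) ^ (n div 5)) \<longlonglongrightarrow> 0"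
  proof (rule tendsto_sandwich[where f = "\<lambda>_. 0"])
    have "filterlim (\<lambda>n. p n * real (n div 5)) at_top sequentially"
      using p lim by (intro filterlim_div5_mult) auto
    then show "(\<lambda>n. exp (- (p n * real (n div 5)))) \<longlonglongrightarrow> 0"
      by (intro filterlim_compose[OF exp_at_bot] filterlim_compose[OF filterlim_uminus_at_bot_at_top])
    show "eventually (\<lambda>n. 0 \<le> (1 - p n) ^ (n div 5)) sequentially"
      using eventually_ge_at_top[of 1] by eventually_elim (use p in \<open>force intro: zero_le_power\<close>)
    show "eventually (\<lambda>n. (1 - p n) ^ (n div 5) \<le> exp (- (p n * real (n div 5)))) sequentially"
      using eventually_ge_at_top[of 1]
      by eventually_elim (use p in \<open>force intro: one_minus_power_le_exp\<close>)
  qed auto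
  show ?thesis
    using tendsto_add[OF tendsto_add[OF 1 tendsto_mult_left[OF 2]]
        tendsto_mult_left[OF tendsto_mult_left[OF 3]]] by simp
qed

subsection \<open>The block decomposition\<close>

text \<open>The intermediate vertices allowed in \<open>out2\<close> are those of the block \<open>L\<close> that are weaker
  than \<open>x\<close>, and in \<open>in2\<close> those of \<open>U\<close> that are stronger than \<open>y\<close>.\<close>

definition out2 :: "nat \<Rightarrow> (nat \<times> nat \<Rightarrow> bool) \<Rightarrow> nat \<Rightarrow> nat set" where
  "out2 n r x = {a \<in> {n div 5<..2 * (n div 5)}.
     \<exists>z\<in>{max x (n - n div 5)<..n}. \<not> r (x, z) \<and> r (a, z)}"

definition in2 :: "nat \<Rightarrow> (nat \<times> nat \<Rightarrow> bool) \<Rightarrow> nat \<Rightarrow> nat set" where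
  "in2 n r y = {b \<in> {n - 2 * (n div 5)<..n - n div 5}.
     \<exists>w\<in>{1..min (y - 1) (n div 5)}. \<not> r (w, y) \<and> r (w, b)}"

text \<open>\<open>4 <= K\<close> makes the relevant integer square roots at least 2,
  \<open>K <= q\<close> places the \<open>K\<close> extreme alternatives at either end inside
  \<open>U\<close> and \<open>L\<close>, and the 2 in \<open>pq\<close> absorbs the rounding in
  \<open>q div floor_sqrt k\<close>.\<close>

locale condorcet_blocks =
  fixes n K q :: nat and p :: real
  assumes q: "q = n div 5" and K: "4 \<le> K" "K \<le> q"
    and p: "0 \<le> p" "p \<le> 1 / 2" and pq: "2 \<le> p * real q"
begin

abbreviation P :: "((nat \<times> nat \<Rightarrow> bool) set) \<Rightarrow> real" where
  "P \<equiv> measure_pmf.prob (Pi_pmf (index_pairs n) False (\<lambda>_. bernoulli_pmf p))"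

abbreviation U :: "nat set" where "U \<equiv> {1..q}"
abbreviation A :: "nat set" where "A \<equiv> {q<..2 * q}"
abbreviation M :: "nat set" where "M \<equiv> {2 * q<..n - 2 * q}"
abbreviation C :: "nat set" where "C \<equiv> {n - 2 * q<..n - q}"
abbreviation L :: "nat set" where "L \<equiv> {n - q<..n}"

text \<open>The total failure bound for all searches in one direction; \<open>k\<close> counts the
  alternatives beyond the searching one, and at most \<open>q\<close> of them are used.\<close>

definition F :: real where
  "F = (\<Sum>k = K..<n - 2 * q. two_step_err (min k q))"

lemma five_q: "5 * q \<le> n"
  by (simp add: q)

lemma p_le_1: "p \<le> 1"
  using p by simp

section \<open>Failure probabilities of the connections within one or two steps\<close>

text \<open>Each \<open>v\<close> in \<open>M\<close> carries \<open>a\<close> to \<open>b\<close>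
  by two arcs from stronger to weaker, with probability at least \<open>1 / 4\<close>, independently
  over \<open>v\<close>.\<close>

lemma prob_no_common_middle:
  "P {r. \<exists>a\<in>A. \<exists>b\<in>C. \<forall>v\<in>M. r (a, v) \<or> r (v, b)} \<le> (real n)\<^sup>2 * (3 / 4) ^ q"
proof -
  have single: "P {r. \<forall>v\<in>M. r (a, v) \<or> r (v, b)} \<le> (3 / 4) ^ q" if ab: "a \<in> A" "b \<in> C" for a b
  proof -
    have "P {r. r (a, v) \<or> r (v, b)} \<le> 3 / 4" if v: "v \<in> M" for v
    proof -
      have "(a, v) \<noteq> (v, b)" using v ab by auto
      then have card: "card {(a, v), (v, b)} = 2" by simp
      have sub: "{(a, v), (v, b)} \<subseteq> index_pairs n"
        using v ab five_q by (auto simp: index_pairs_def)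
      have "P {r. \<forall>e\<in>{(a, v), (v, b)}. \<not> r e} = (1 - p)\<^sup>2"
        using prob_Pi_bernoulli_all(2)[OF finite_index_pairs sub p(1) p_le_1] card by simp
      moreover have "(1 / 2)\<^sup>2 \<le> (1 - p)\<^sup>2"
        using p by (intro power_mono) auto
      ultimately have "1 / 4 \<le> P {r. \<forall>e\<in>{(a, v), (v, b)}. \<not> r e}"
        by (simp add: power2_eq_square)
      also have "\<dots> = P {r. \<not> (r (a, v) \<or> r (v, b))}" by simp
      also have "\<dots> = 1 - P {r. r (a, v) \<or> r (v, b)}" by (rule prob_neg)
      finally show ?thesis by simp
    qed
    moreover have "{(a, v), (v, b)} \<subseteq> index_pairs n" if "v \<in> M" for v
      using that ab five_q by (auto simp: index_pairs_def)
    moreover have "disjoint_family_on (\<lambda>v. {(a, v), (v, b)}) M"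
      using ab by (auto simp: disjoint_family_on_def)
    ultimately have "P {r. \<forall>v\<in>M. r (a, v) \<or> r (v, b)} \<le> (3 / 4) ^ card M"
      by (intro prob_all_le[OF finite_index_pairs, where S = "\<lambda>v. {(a, v), (v, b)}"])
        (simp_all add: depends_on_def)
    also have "\<dots> \<le> (3 / 4) ^ q"
      using five_q by (intro power_decreasing) auto
    finally show ?thesis .
  qed
  have "P {r. \<exists>a\<in>A. \<exists>b\<in>C. \<forall>v\<in>M. r (a, v) \<or> r (v, b)}
      \<le> (\<Sum>a\<in>A. P {r. \<exists>b\<in>C. \<forall>v\<in>M. r (a, v) \<or> r (v, b)})"
    by (rule prob_bex_le) simp
  also have "\<dots> \<le> (\<Sum>a\<in>A. \<Sum>b\<in>C. P {r. \<forall>v\<in>M. r (a, v) \<or> r (v, b)})"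
    by (intro sum_mono prob_bex_le) simp
  also have "\<dots> \<le> (\<Sum>a\<in>A. \<Sum>b\<in>C. (3 / 4) ^ q)"
    by (intro sum_mono single)
  also have "\<dots> = (real (card A) * real (card C)) * (3 / 4) ^ q"
    by simp
  also have "\<dots> \<le> (real n * real n) * (3 / 4) ^ q"
    using five_q by (intro mult_right_mono mult_mono) auto
  finally show ?thesis by (simp add: power2_eq_square)
qed

lemma prob_bex_all_le:
  assumes "finite X" "card X \<le> m" and "\<And>x. x \<in> X \<Longrightarrow> P {r. E x r} \<le> c" and "0 \<le> c"
  shows "P {r. \<exists>x\<in>X. E x r} \<le> real m * c"
proof -
  have "P {r. \<exists>x\<in>X. E x r} \<le> (\<Sum>x\<in>X. P {r. E x r})"
    by (rule prob_bex_le) fact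
  also have "\<dots> \<le> real (card X) * c"
    using assms(3) by (rule sum_bounded_above)
  also have "\<dots> \<le> real m * c"
    using assms by (intro mult_right_mono) auto
  finally show ?thesis .
qed

lemma prob_all_edges_le:
  assumes "inj_on e X" "e ` X \<subseteq> index_pairs n" "card X = q"
  shows "P {r. \<forall>a\<in>X. r (e a)} \<le> (1 / 2) ^ q" "P {r. \<forall>a\<in>X. \<not> r (e a)} \<le> (1 - p) ^ q"
proof -
  have "card (e ` X) = q" using assms by (simp add: card_image)
  then have "P {r. \<forall>a\<in>X. r (e a)} = p ^ q" "P {r. \<forall>a\<in>X. \<not> r (e a)} = (1 - p) ^ q"
    using prob_Pi_bernoulli_all[OF finite_index_pairs assms(2) p(1) p_le_1] by simp_all
  moreover have "p ^ q \<le> (1 / 2) ^ q" using p by (intro power_mono)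
  ultimately show "P {r. \<forall>a\<in>X. r (e a)} \<le> (1 / 2) ^ q" "P {r. \<forall>a\<in>X. \<not> r (e a)} \<le> (1 - p) ^ q"
    by simp_all
qed

lemma prob_U_misses_A: "P {r. \<exists>x\<in>U. \<forall>a\<in>A. r (x, a)} \<le> real n * (1 / 2) ^ q"
  using five_q by (intro prob_bex_all_le prob_all_edges_le) (auto simp: inj_on_def index_pairs_def)

lemma prob_C_misses_L: "P {r. \<exists>y\<in>L. \<forall>b\<in>C. r (b, y)} \<le> real n * (1 / 2) ^ q"
  using five_q by (intro prob_bex_all_le prob_all_edges_le) (auto simp: inj_on_def index_pairs_def)

text \<open>Arcs towards \<open>A\<close> from below have only probability \<open>p\<close>. A union
  over all weaker alternatives would cost \<open>n * (1 - p) ^ q\<close>, which need not be small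
  when \<open>n * p\<close> grows slowly; hence only \<open>K\<close> of them.\<close>

lemma prob_bottom_misses_A:
  "P {r. \<exists>x\<in>{n - K<..n}. \<forall>a\<in>A. \<not> r (a, x)} \<le> real K * (1 - p) ^ q"
  using five_q K p_le_1
  by (intro prob_bex_all_le prob_all_edges_le) (auto simp: inj_on_def index_pairs_def)

lemma prob_C_misses_top:
  "P {r. \<exists>y\<in>{1..K}. \<forall>b\<in>C. \<not> r (y, b)} \<le> real K * (1 - p) ^ q"
  using five_q K p_le_1
  by (intro prob_bex_all_le prob_all_edges_le) (auto simp: inj_on_def index_pairs_def)

text \<open>Cutting a block of size \<open>q\<close> into \<open>s\<close> parts of size
  \<open>d = q div s\<close> keeps \<open>p * d * s\<close> at least \<open>p * q / 2\<close>, hence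
  at least 1.\<close>

lemma few_two_step_le_err:
  assumes k: "K \<le> k" "k \<le> q"
  shows "real (floor_sqrt k) * (1 - (1 - p) * (1 - (1 - p) ^ (q div floor_sqrt k))) ^ k \<le> two_step_err k"
proof -
  define s where "s = floor_sqrt k"
  have s: "1 \<le> s" "s\<^sup>2 \<le> k" "s \<le> q"
    using k K floor_sqrt_le[of k] floor_sqrt_greater_zero_iff[of k] by (auto simp: s_def simp del: floor_sqrt_greater_zero_iff)
  define d where "d = q div s"
  have "1 \<le> d" using s by (simp add: d_def div_greater_zero_iff Suc_le_eq)
  have "q mod s < s" using s by simp
  \<comment> \<open>The remainder is below \<open>s\<close>, hence below \<open>d * s\<close>:
    rounding loses at most a factor 2.\<close>
  then have "q \<le> s * d + s" using mult_div_mod_eq[of s q] unfolding d_def by linarith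
  also have "\<dots> \<le> 2 * (d * s)" using \<open>1 \<le> d\<close> by simp
  finally have "real q \<le> 2 * (real d * real s)"
    by (metis of_nat_le_iff of_nat_mult of_nat_numeral)
  then have "p * real q \<le> p * (2 * (real d * real s))"
    using p by (intro mult_left_mono)
  with pq have "1 \<le> p * real d * real s" by simp
  then have "(1 - (1 - p) * (1 - (1 - p) ^ d)) ^ k \<le> exp (- real s / 4)"
    using p s by (intro two_step_miss_le_exp)
  then show ?thesis
    by (auto simp: two_step_err_def s_def d_def intro: mult_left_mono)
qed

text \<open>Instance with \<open>e z = (x, z)\<close> and \<open>g z a = (a, z)\<close>. These pairs
  differ because \<open>x\<close> is weaker than all of \<open>A\<close>, and exactly
  \<open>min (n - x) q\<close> intermediate vertices are available.\<close>

lemma prob_few_out2: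
  assumes x: "x \<in> {2 * q<..n - K}"
  shows "P {r. card (out2 n r x) < floor_sqrt (min (n - x) q)} \<le> two_step_err (min (n - x) q)"
proof -
  define k where "k = min (n - x) q"
  let ?Z = "{max x (n - q)<..n}"
  have k: "K \<le> k" "k \<le> q" "card ?Z = k" using x K five_q by (auto simp: k_def)
  have "P {r. card {a\<in>A. \<exists>z\<in>?Z. \<not> r (x, z) \<and> r (a, z)} < floor_sqrt k}
     \<le> real (floor_sqrt k) * (1 - (1 - p) * (1 - (1 - p) ^ (q div floor_sqrt k))) ^ card ?Z"
    using x five_q p p_le_1
    by (intro prob_few_two_step_le[OF finite_index_pairs]) (auto simp: inj_on_def index_pairs_def)
  also have "\<dots> \<le> two_step_err k"
    unfolding k(3) using k by (intro few_two_step_le_err)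
  finally show ?thesis by (simp add: out2_def k_def q)
qed

lemma prob_few_in2:
  assumes y: "y \<in> {K<..n - 2 * q}"
  shows "P {r. card (in2 n r y) < floor_sqrt (min (y - 1) q)} \<le> two_step_err (min (y - 1) q)"
proof -
  define k where "k = min (y - 1) q"
  let ?W = "{1..min (y - 1) q}"
  have k: "K \<le> k" "k \<le> q" "card ?W = k" using y K by (auto simp: k_def)
  have "P {r. card {b\<in>C. \<exists>w\<in>?W. \<not> r (w, y) \<and> r (w, b)} < floor_sqrt k}
     \<le> real (floor_sqrt k) * (1 - (1 - p) * (1 - (1 - p) ^ (q div floor_sqrt k))) ^ card ?W"
    using y five_q p p_le_1
    by (intro prob_few_two_step_le[OF finite_index_pairs]) (auto simp: inj_on_def index_pairs_def)
  also have "\<dots> \<le> two_step_err k"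
    unfolding k(3) using k by (intro few_two_step_le_err)
  finally show ?thesis by (simp add: in2_def k_def q)
qed

lemma sum_err_below: "(\<Sum>x\<in>{2 * q<..n - K}. two_step_err (min (n - x) q)) = F"
  unfolding F_def
  by (rule sum.reindex_bij_witness[where i = "\<lambda>k. n - k" and j = "\<lambda>x. n - x"]) (use K five_q in auto)

lemma sum_err_above: "(\<Sum>y\<in>{K<..n - 2 * q}. two_step_err (min (y - 1) q)) = F"
  unfolding F_def
  by (rule sum.reindex_bij_witness[where i = Suc and j = "\<lambda>y. y - 1"]) auto

lemma prob_ex_few_out2:
  "P {r. \<exists>x\<in>{2 * q<..n - K}. card (out2 n r x) < floor_sqrt (min (n - x) q)} \<le> F"
proof -
  have "P {r. \<exists>x\<in>{2 * q<..n - K}. card (out2 n r x) < floor_sqrt (min (n - x) q)}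
      \<le> (\<Sum>x\<in>{2 * q<..n - K}. P {r. card (out2 n r x) < floor_sqrt (min (n - x) q)})"
    by (rule prob_bex_le) simp
  also have "\<dots> \<le> F"
    unfolding sum_err_below[symmetric] by (intro sum_mono prob_few_out2)
  finally show ?thesis .
qed

lemma prob_ex_few_in2:
  "P {r. \<exists>y\<in>{K<..n - 2 * q}. card (in2 n r y) < floor_sqrt (min (y - 1) q)} \<le> F"
proof -
  have "P {r. \<exists>y\<in>{K<..n - 2 * q}. card (in2 n r y) < floor_sqrt (min (y - 1) q)}
      \<le> (\<Sum>y\<in>{K<..n - 2 * q}. P {r. card (in2 n r y) < floor_sqrt (min (y - 1) q)})"
    by (rule prob_bex_le) simp
  also have "\<dots> \<le> F"
    unfolding sum_err_above[symmetric] by (intro sum_mono prob_few_in2)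
  finally show ?thesis .
qed

section \<open>Linking the two searches by a direct arc\<close>

text \<open>Both size conditions belong to the event: with small or empty sets the last conjunct
  could be likely, or even vacuous. Searches that find too little are bounded separately.\<close>

definition unlinked :: "(nat \<times> nat \<Rightarrow> bool) \<Rightarrow> nat \<Rightarrow> nat \<Rightarrow> bool" where
  "unlinked r x y \<longleftrightarrow> floor_sqrt (min (n - x) q) \<le> card (out2 n r x) \<and>
     floor_sqrt (min (y - 1) q) \<le> card (in2 n r y) \<and> (\<forall>a\<in>out2 n r x. \<forall>b\<in>in2 n r y. r (a, b))"

lemma out2_subset: "out2 n r x \<subseteq> A"
  by (auto simp: out2_def q)

lemma in2_subset: "in2 n r y \<subseteq> C"
  by (auto simp: in2_def q)

text \<open>The searches read no coordinate in \<open>A \<times> C\<close>, so the sets they find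
  can be treated as fixed; then all \<open>s * t\<close> linking arcs point the wrong way with
  probability at most \<open>(1 / 2) ^ (s * t)\<close>.\<close>

lemma prob_unlinked:
  assumes x: "x \<in> {2 * q<..n - K}" and y: "y \<in> {K<..n - 2 * q}"
  shows "P {r. unlinked r x y} \<le> two_step_err (min (n - x) q) * two_step_err (min (y - 1) q)"
proof -
  let ?s = "floor_sqrt (min (n - x) q)" and ?t = "floor_sqrt (min (y - 1) q)"
  define X where "X r = (out2 n r x, in2 n r y)" for r
  define E where "E b r \<longleftrightarrow> ?s \<le> card (fst b) \<and> ?t \<le> card (snd b) \<and> (\<forall>e\<in>fst b \<times> snd b. r e)"
    for b :: "nat set \<times> nat set" and r :: "nat \<times> nat \<Rightarrow> bool"
  have range: "fst b \<subseteq> A" "snd b \<subseteq> C" if "b \<in> range X" for b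
  proof -
    from that obtain r where "b = X r" by blast
    then show "fst b \<subseteq> A" "snd b \<subseteq> C" using out2_subset in2_subset by (simp_all add: X_def)
  qed
  have "P {r. E (X r) r} \<le> (1 / 2) ^ (?s * ?t)"
  proof (rule prob_depending_le[where X = X and E = E
        and S = "index_pairs n - A \<times> C" and T = "A \<times> C"])
    show "depends_on (index_pairs n - A \<times> C) X"
    proof (rule depends_onI)
      fix f g :: "nat \<times> nat \<Rightarrow> bool"
      assume fg: "f e = g e" if "e \<in> index_pairs n - A \<times> C" for e
      \<comment> \<open>\<open>z\<close> lies in \<open>L\<close>, beyond \<open>C\<close>, so
        neither pair is in \<open>A \<times> C\<close>.\<close>
      have out: "f (x, z) = g (x, z)" "\<And>a. a \<in> A \<Longrightarrow> f (a, z) = g (a, z)"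
        if "z \<in> {max x (n - q)<..n}" for z
        using that x five_q by (auto intro!: fg simp: index_pairs_def)
      have out2_eq: "out2 n f x = out2 n g x"
        unfolding out2_def q[symmetric]
        by (intro Collect_cong conj_cong bex_cong refl) (simp_all only: out)
      \<comment> \<open>\<open>w\<close> lies in \<open>U\<close>, before \<open>A\<close>, so again
        neither pair is in \<open>A \<times> C\<close>.\<close>
      have in_: "f (w, y) = g (w, y)" "\<And>b. b \<in> C \<Longrightarrow> f (w, b) = g (w, b)"
        if "w \<in> {1..min (y - 1) q}" for w
        using that y five_q by (auto intro!: fg simp: index_pairs_def)
      have in2_eq: "in2 n f y = in2 n g y"
        unfolding in2_def q[symmetric]
        by (intro Collect_cong conj_cong bex_cong refl) (simp_all only: in_)
      show "X f = X g"
        by (simp only: X_def out2_eq in2_eq)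
    qed
    have "X r \<in> Pow A \<times> Pow C" for r
      using out2_subset[of r x] in2_subset[of r y] unfolding X_def by blast
    then have "range X \<subseteq> Pow A \<times> Pow C"
      by (rule image_subsetI)
    then show "finite (range X)"
      by (rule finite_subset) simp
    fix b assume b: "b \<in> range X"
    show "depends_on (A \<times> C) (E b)"
    proof (rule depends_onI)
      fix f g :: "nat \<times> nat \<Rightarrow> bool"
      assume fg: "f e = g e" if "e \<in> A \<times> C" for e
      have "f e = g e" if "e \<in> fst b \<times> snd b" for e
        using that range[OF b] by (intro fg) blast
      then have "(\<forall>e\<in>fst b \<times> snd b. f e) = (\<forall>e\<in>fst b \<times> snd b. g e)"
        by (intro ball_cong refl)
      then show "E b f = E b g" by (simp only: E_def)
    qed
    show "P {r. E b r} \<le> (1 / 2) ^ (?s * ?t)"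
    proof (cases "?s \<le> card (fst b) \<and> ?t \<le> card (snd b)")
      case True
      have "fst b \<times> snd b \<subseteq> A \<times> C" using range[OF b] by auto
      also have "\<dots> \<subseteq> index_pairs n" using five_q by (auto simp: index_pairs_def)
      finally have "P {r. \<forall>e\<in>fst b \<times> snd b. r e} = p ^ card (fst b \<times> snd b)"
        using p(1) p_le_1 by (intro prob_Pi_bernoulli_all(1)) auto
      also have "\<dots> \<le> (1 / 2) ^ card (fst b \<times> snd b)"
        using p by (intro power_mono)
      also have "\<dots> \<le> (1 / 2) ^ (?s * ?t)"
        using True unfolding card_cartesian_product by (intro power_decreasing mult_le_mono) auto
      finally show ?thesis using True by (simp add: E_def)
    next
      case False
      then have "{r. E b r} = {}" by (auto simp: E_def)
      then show ?thesis by simp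
    qed
  qed auto
  also have "\<dots> \<le> two_step_err (min (n - x) q) * two_step_err (min (y - 1) q)"
    using x y K by (intro half_power_le_two_step_err) auto
  finally show ?thesis
    by (simp add: E_def X_def unlinked_def)
qed

lemma prob_ex_unlinked:
  "P {r. \<exists>x\<in>{2 * q<..n - K}. \<exists>y\<in>{K<..n - 2 * q}. unlinked r x y} \<le> F\<^sup>2"
proof -
  have "P {r. \<exists>x\<in>{2 * q<..n - K}. \<exists>y\<in>{K<..n - 2 * q}. unlinked r x y}
      \<le> (\<Sum>x\<in>{2 * q<..n - K}. P {r. \<exists>y\<in>{K<..n - 2 * q}. unlinked r x y})"
    by (rule prob_bex_le) simp
  also have "\<dots> \<le> (\<Sum>x\<in>{2 * q<..n - K}. \<Sum>y\<in>{K<..n - 2 * q}. P {r. unlinked r x y})"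
    by (intro sum_mono prob_bex_le) simp
  also have "\<dots> \<le> (\<Sum>x\<in>{2 * q<..n - K}. \<Sum>y\<in>{K<..n - 2 * q}. two_step_err (min (n - x) q) * two_step_err (min (y - 1) q))"
    by (intro sum_mono prob_unlinked)
  also have "\<dots> = F\<^sup>2"
    unfolding sum_product[symmetric] sum_err_below sum_err_above by (simp add: power2_eq_square)
  finally show ?thesis .
qed

section \<open>The good event and its probability\<close>

definition good :: "(nat \<times> nat \<Rightarrow> bool) \<Rightarrow> bool" where
  "good r \<longleftrightarrow> \<not> ((\<exists>a\<in>A. \<exists>b\<in>C. \<forall>v\<in>M. r (a, v) \<or> r (v, b)) \<or>
     (\<exists>x\<in>U. \<forall>a\<in>A. r (x, a)) \<or> (\<exists>y\<in>L. \<forall>b\<in>C. r (b, y)) \<or>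
     (\<exists>x\<in>{n - K<..n}. \<forall>a\<in>A. \<not> r (a, x)) \<or> (\<exists>y\<in>{1..K}. \<forall>b\<in>C. \<not> r (y, b)) \<or>
     (\<exists>x\<in>{2 * q<..n - K}. card (out2 n r x) < floor_sqrt (min (n - x) q)) \<or>
     (\<exists>y\<in>{K<..n - 2 * q}. card (in2 n r y) < floor_sqrt (min (y - 1) q)) \<or>
     (\<exists>x\<in>{2 * q<..n - K}. \<exists>y\<in>{K<..n - 2 * q}. unlinked r x y))"

lemma prob_good_ge:
  "1 - ((real n)\<^sup>2 * (3 / 4) ^ q + 2 * (real n * (1 / 2) ^ q) + 2 * (real K * (1 - p) ^ q)
      + 2 * F + F\<^sup>2) \<le> P {r. good r}"
proof -
  \<comment> \<open>Applied repeatedly along the right-nested disjunction, which is why the sum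
    below is nested to the right.\<close>
  note le = order_trans[OF prob_disj_le add_mono]
  have "P {r. \<not> good r} \<le> (real n)\<^sup>2 * (3 / 4) ^ q + (real n * (1 / 2) ^ q + (real n * (1 / 2) ^ q
      + (real K * (1 - p) ^ q + (real K * (1 - p) ^ q + (F + (F + F\<^sup>2))))))"
    unfolding good_def not_not
    by (intro le prob_no_common_middle prob_U_misses_A prob_C_misses_L prob_bottom_misses_A
        prob_C_misses_top prob_ex_few_out2 prob_ex_few_in2 prob_ex_unlinked)
  then show ?thesis by (simp add: prob_neg)
qed

section \<open>From the good event to short paths\<close>

lemma arc_downI: "1 \<le> i \<Longrightarrow> i < j \<Longrightarrow> j \<le> n \<Longrightarrow> \<not> r (i, j) \<Longrightarrow> (i, j) \<in> parcs (tournament_of n r)"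
  by (auto simp: tournament_of_def index_pairs_def)

lemma arc_upI: "1 \<le> i \<Longrightarrow> i < j \<Longrightarrow> j \<le> n \<Longrightarrow> r (i, j) \<Longrightarrow> (j, i) \<in> parcs (tournament_of n r)"
  by (auto simp: tournament_of_def index_pairs_def)

lemma relpow2I: "(x, y) \<in> D \<Longrightarrow> (y, z) \<in> D \<Longrightarrow> (x, z) \<in> D ^^ 2"
  by (auto simp: numeral_2_eq_2)

text \<open>The walk goes down from \<open>x\<close> to a weaker \<open>z\<close> in
  \<open>L\<close>, then up along a reversed arc to \<open>a\<close>.\<close>

lemma out2_relpow:
  assumes "x \<in> {2 * q<..n - K}" "a \<in> out2 n r x"
  shows "a \<in> A" "(x, a) \<in> parcs (tournament_of n r) ^^ 2"
proof -
  from assms(2) obtain z where z: "a \<in> A" "z \<in> {max x (n - q)<..n}" "\<not> r (x, z)" "r (a, z)"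
    unfolding out2_def q[symmetric] by blast
  then show "a \<in> A" by simp
  have "(x, z) \<in> parcs (tournament_of n r)" using z assms by (intro arc_downI) auto
  moreover have "(z, a) \<in> parcs (tournament_of n r)" using z five_q by (intro arc_upI) auto
  ultimately show "(x, a) \<in> parcs (tournament_of n r) ^^ 2" by (rule relpow2I)
qed

lemma in2_relpow:
  assumes "y \<in> {K<..n - 2 * q}" "b \<in> in2 n r y"
  shows "b \<in> C" "(b, y) \<in> parcs (tournament_of n r) ^^ 2"
proof -
  from assms(2) obtain w where w: "b \<in> C" "w \<in> {1..min (y - 1) q}" "\<not> r (w, y)" "r (w, b)"
    unfolding in2_def q[symmetric] by blast
  then show "b \<in> C" by simp
  have "(w, y) \<in> parcs (tournament_of n r)" using w assms by (intro arc_downI) auto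
  moreover have "(b, w) \<in> parcs (tournament_of n r)" using w five_q by (intro arc_upI) auto
  ultimately show "(b, y) \<in> parcs (tournament_of n r) ^^ 2" by (blast intro: relpow2I)
qed

lemma good_reach:
  assumes good: "good r" and xy: "x \<in> {1..n}" "y \<in> {1..n}"
  shows "\<exists>j\<le>5. (x, y) \<in> parcs (tournament_of n r) ^^ j"
proof -
  let ?D = "parcs (tournament_of n r)"
  \<comment> \<open>Guarantees that a successful search finds at least one vertex.\<close>
  have pos: "0 < floor_sqrt (min (n - x) q)" if "x \<in> {2 * q<..n - K}" for x
    using that K five_q by auto
  have pos': "0 < floor_sqrt (min (y - 1) q)" if "y \<in> {K<..n - 2 * q}" for y
    using that K five_q by auto
  have x_cases: "(\<exists>a\<in>A. \<exists>i\<le>1. (x, a) \<in> ?D ^^ i) \<or> x \<in> {2 * q<..n - K}"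
  proof -
    consider "x \<in> U" | "x \<in> A" | "x \<in> {2 * q<..n - K}" | "x \<in> {n - K<..n}"
      using xy by fastforce
    then show ?thesis
    proof cases
      case 1
      then obtain a where a: "a \<in> A" "\<not> r (x, a)" using good unfolding good_def by blast
      then have "(x, a) \<in> ?D" using 1 five_q by (intro arc_downI) auto
      then have "(x, a) \<in> ?D ^^ 1" by simp
      with a show ?thesis by blast
    next
      case 2
      have "(x, x) \<in> ?D ^^ 0" by simp
      with 2 show ?thesis by (meson zero_le)
    next
      case 4
      then obtain a where a: "a \<in> A" "r (a, x)" using good unfolding good_def by blast
      then have "(x, a) \<in> ?D" using 4 five_q K by (intro arc_upI) auto
      then have "(x, a) \<in> ?D ^^ 1" by simp
      with a show ?thesis by blast
    qed blast
  qed
  have y_cases: "(\<exists>b\<in>C. \<exists>i\<le>1. (b, y) \<in> ?D ^^ i) \<or> y \<in> {K<..n - 2 * q}"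
  proof -
    consider "y \<in> L" | "y \<in> C" | "y \<in> {K<..n - 2 * q}" | "y \<in> {1..K}"
      using xy by fastforce
    then show ?thesis
    proof cases
      case 1
      then obtain b where b: "b \<in> C" "\<not> r (b, y)" using good unfolding good_def by blast
      then have "(b, y) \<in> ?D" using 1 five_q by (intro arc_downI) auto
      then have "(b, y) \<in> ?D ^^ 1" by simp
      with b show ?thesis by blast
    next
      case 2
      have "(y, y) \<in> ?D ^^ 0" by simp
      with 2 show ?thesis by (meson zero_le)
    next
      case 4
      then obtain b where b: "b \<in> C" "r (y, b)" using good unfolding good_def by blast
      then have "(b, y) \<in> ?D" using 4 five_q K by (intro arc_upI) auto
      then have "(b, y) \<in> ?D ^^ 1" by simp
      with b show ?thesis by blast
    qed blast
  qed
  have middle: "(a, b) \<in> ?D ^^ 2" if ab: "a \<in> A" "b \<in> C" for a b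
  proof -
    obtain v where v: "v \<in> M" "\<not> r (a, v)" "\<not> r (v, b)"
      using good ab unfolding good_def by blast
    have "(a, v) \<in> ?D" "(v, b) \<in> ?D"
      using v ab five_q by (auto intro!: arc_downI)
    then show ?thesis by (rule relpow2I)
  qed
  have join: "\<exists>j\<le>5. (x, y) \<in> ?D ^^ j"
    if "(x, a) \<in> ?D ^^ i" "(a, b) \<in> ?D ^^ k" "(b, y) \<in> ?D ^^ l" "i + k + l \<le> 5" for a b i k l
    using that relpow_trans[OF relpow_trans[OF that(1,2)] that(3)] by blast
  have x_out: "card (out2 n r x) \<ge> floor_sqrt (min (n - x) q)" if "x \<in> {2 * q<..n - K}"
    using good that unfolding good_def by (meson not_le)
  have y_in: "card (in2 n r y) \<ge> floor_sqrt (min (y - 1) q)" if "y \<in> {K<..n - 2 * q}"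
    using good that unfolding good_def by (meson not_le)
  have x_far: "\<exists>a\<in>A. (x, a) \<in> ?D ^^ 2" if x: "x \<in> {2 * q<..n - K}"
  proof -
    have "out2 n r x \<noteq> {}" using x_out[OF x] pos[OF x] by (metis card.empty leD)
    then show ?thesis using out2_relpow[OF x] by blast
  qed
  have y_far: "\<exists>b\<in>C. (b, y) \<in> ?D ^^ 2" if y: "y \<in> {K<..n - 2 * q}"
  proof -
    have "in2 n r y \<noteq> {}" using y_in[OF y] pos'[OF y] by (metis card.empty leD)
    then show ?thesis using in2_relpow[OF y] by blast
  qed
  show ?thesis
  proof (cases "\<exists>a\<in>A. \<exists>i\<le>1. (x, a) \<in> ?D ^^ i")
    case True
    then obtain a i where a: "a \<in> A" "i \<le> 1" "(x, a) \<in> ?D ^^ i" by blast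
    \<comment> \<open>Whether \<open>y\<close> is within one step of \<open>C\<close> or has to be
      reached by a search, two steps suffice.\<close>
    obtain b l where b: "b \<in> C" "l \<le> 2" "(b, y) \<in> ?D ^^ l"
      using y_cases y_far by (meson one_le_numeral order_refl order_trans)
    show ?thesis
      using a b by (intro join[OF a(3) middle b(3)]) auto
  next
    case False
    with x_cases have x: "x \<in> {2 * q<..n - K}" by blast
    show ?thesis
    proof (cases "\<exists>b\<in>C. \<exists>l\<le>1. (b, y) \<in> ?D ^^ l")
      case True
      then obtain b l where b: "b \<in> C" "l \<le> 1" "(b, y) \<in> ?D ^^ l" by blast
      obtain a where a: "a \<in> A" "(x, a) \<in> ?D ^^ 2" using x_far[OF x] by blast
      show ?thesis
        using a b by (intro join[OF a(2) middle b(3)]) auto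
    next
      case False
      with y_cases have y: "y \<in> {K<..n - 2 * q}" by blast
      have "\<not> unlinked r x y" using good x y unfolding good_def by blast
      with x_out[OF x] y_in[OF y] obtain a b
        where ab: "a \<in> out2 n r x" "b \<in> in2 n r y" "\<not> r (a, b)"
        unfolding unlinked_def by blast
      note a = out2_relpow[OF x ab(1)] and b = in2_relpow[OF y ab(2)]
      have "(a, b) \<in> ?D"
        using a(1) b(1) ab(3) five_q by (intro arc_downI) auto
      then have ab1: "(a, b) \<in> ?D ^^ 1" by simp
      show ?thesis by (rule join[OF a(2) ab1 b(2)]) simp
    qed
  qed
qed

lemma good_imp_king:
  assumes "good r" "x \<in> pverts (tournament_of n r)"
  shows "king 5 (tournament_of n r) x"
proof -
  interpret tournament "tournament_of n r" by (rule tournament_tournament_of)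
  have verts: "pverts (tournament_of n r) = {1..n}" by (simp add: tournament_of_def)
  have "\<exists>P. apath x P y \<and> length P \<le> 5" if y: "y \<in> pverts (tournament_of n r)" for y
  proof -
    obtain j where j: "j \<le> 5" "(x, y) \<in> parcs (tournament_of n r) ^^ j"
      using good_reach[OF assms(1)] assms(2) y unfolding verts by blast
    show ?thesis
      using relpow_imp_apath[OF assms(2) j(2)] j(1) by (meson order_trans)
  qed
  with assms(2) show ?thesis by (simp add: king_def)
qed

lemma prob_kings_ge:
  "1 - ((real n)\<^sup>2 * (3 / 4) ^ q + 2 * (real n * (1 / 2) ^ q) + 2 * (real K * (1 - p) ^ q)
      + 2 * F + F\<^sup>2)
    \<le> measure_pmf.prob (condorcet_pmf n p) {T. \<forall>x\<in>pverts T. king 5 T x}"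
proof -
  have "P {r. good r} \<le> P (tournament_of n -` {T. \<forall>x\<in>pverts T. king 5 T x})"
    using good_imp_king by (intro measure_pmf.finite_measure_mono) auto
  with prob_good_ge show ?thesis by (simp add: condorcet_pmf_def)
qed

end

section \<open>Passage to the limit\<close>

theorem theorem3:
  fixes p :: "nat \<Rightarrow> real"
  assumes p_range: "\<And>n. n \<ge> 1 \<Longrightarrow> 0 \<le> p n \<and> p n \<le> 1 / 2"
    and np_at_top: "filterlim (\<lambda>n. real n * p n) at_top sequentially"
  shows "(\<lambda>n. measure_pmf.prob (condorcet_pmf n (p n)) {T. \<forall>x \<in> pverts T. king 5 T x})
           \<longlonglongrightarrow> 1"
proof (rule order_tendstoI)
  fix a :: real
  assume "a < 1"
  \<comment> \<open>The failure bound is below \<open>\<epsilon> + 2 * F + F\<^sup>2\<close> with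
    \<open>F < \<epsilon>\<close>. The cap at 1 gives \<open>F\<^sup>2 \<le> F\<close>, so the total
    stays below \<open>4 * \<epsilon>\<close>, hence below \<open>1 - a\<close>.\<close>
  define \<epsilon> where "\<epsilon> = min 1 ((1 - a) / 4)"
  have \<epsilon>: "0 < \<epsilon>" "\<epsilon> \<le> 1" "4 * \<epsilon> \<le> 1 - a" using \<open>a < 1\<close> by (auto simp: \<epsilon>_def min_def)
  obtain K where K: "4 \<le> K"
    and sum: "eventually (\<lambda>n. (\<Sum>k = K..<n - 2 * (n div 5). two_step_err (min k (n div 5))) < \<epsilon>) sequentially"
    using eventually_sum_two_step_err_less[OF \<epsilon>(1)] .
  have "eventually (\<lambda>n. (real n)\<^sup>2 * (3 / 4) ^ (n div 5) + 2 * (real n * (1 / 2) ^ (n div 5))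
      + 2 * (real K * (1 - p n) ^ (n div 5)) < \<epsilon>) sequentially"
    using small_terms_tendsto_0[OF p_range np_at_top] \<epsilon>(1) by (rule order_tendstoD)
  moreover have "eventually (\<lambda>n. 2 \<le> p n * real (n div 5)) sequentially"
    using filterlim_div5_mult[OF _ np_at_top] p_range unfolding filterlim_at_top by blast
  moreover have "eventually (\<lambda>n. K \<le> n div 5) sequentially"
    using filterlim_div5 unfolding filterlim_at_top by blast
  ultimately show "eventually (\<lambda>n. a < measure_pmf.prob (condorcet_pmf n (p n))
      {T. \<forall>x \<in> pverts T. king 5 T x}) sequentially"
    using sum eventually_ge_at_top[of 1]
  proof eventually_elim
    case (elim n)
    interpret condorcet_blocks n K "n div 5" "p n"
      using elim K p_range[of n] by unfold_locales auto
    have F: "F < \<epsilon>" "0 \<le> F"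
      using elim(4) by (auto simp: F_def two_step_err_nonneg intro: sum_nonneg)
    then have "F\<^sup>2 \<le> F * 1"
      using \<epsilon>(2) unfolding power2_eq_square by (intro mult_left_mono) auto
    then show ?case
      using prob_kings_ge elim(1) F \<epsilon>(3) by linarith
  qed
next
  fix a :: real
  assume "1 < a"
  then show "eventually (\<lambda>n. measure_pmf.prob (condorcet_pmf n (p n))
      {T. \<forall>x \<in> pverts T. king 5 T x} < a) sequentially"
    by (intro always_eventually allI) (meson le_less_trans measure_pmf.prob_le_1)
qed

end
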